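(* For any attachment rule $f$ and any fixed vertex labelled $m\in\mathbb N$, $$\lim_{n\to\infty}\frac{\Phi(\mathcal Z[m,n])}{\Psi(n)}=1\qquad\text{almost surely.}$$
   Context: $\mathbb Z_+=\{0,1,2,\dots\}$, $\mathbb N=\{1,2,\dots\}$. An attachment rule is a monotonically increasing (nondecreasing) function $f:\mathbb Z_+\to(0,\infty)$ with $f(n)\le n+1$ for all $n\in\mathbb Z_+$. The network evolves as follows: at time $n=1$ it consists of a single vertex, labelled $1$, without edges. In the step $n\to n+1$ a new vertex labelled $n+1$ is added and, independently for each old vertex $m\in\{1,\dots,n\}$ (given the graph at time $n$), a directed edge $n+1\to m$ is inserted with probability $f(\text{indegree of } m \text{ at time } n)/n$. For $m\le n$, $\mathcal Z[m,n]$ denotes the indegree of vertex $m$ after insertion of vertex $n$. Moreover $\Psi(n)=\sum_{m=1}^{n-1}\frac1m$ for $n\in\mathbb N$ and $\Phi(j)=\sum_{k=0}^{j-1}\frac1{f(k)}$ for $j\in\mathbb Z_+$. *)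

theory Defs
  imports "HOL-Probability.Probability" "Graph_Theory.Pair_Digraph"
begin

definition attachment_rule :: "(nat \<Rightarrow> real) \<Rightarrow> bool" where
  "attachment_rule f \<longleftrightarrow> mono f \<and> (\<forall>n. 0 < f n) \<and> (\<forall>n. f n \<le> real n + 1)"

definition Psi :: "nat \<Rightarrow> real" where
  "Psi n = (\<Sum>m\<in>{1..<n}. 1 / real m)"

definition Phi :: "(nat \<Rightarrow> real) \<Rightarrow> nat \<Rightarrow> real" where
  "Phi f j = (\<Sum>k<j. 1 / f k)"

text \<open>
  \<open>G n \<omega>\<close> is the network at time \<open>n \<ge> 1\<close>; \<open>G 0\<close> is unconstrained. An arc \<open>(k, m)\<close> points from
  \<open>k\<close> to \<open>m\<close>. Since every arc carries the label of the vertex that created it, the graph at time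
  \<open>n\<close> determines all earlier ones, so conditioning on it is conditioning on the whole past. Only
  finitely many graphs \<open>g\<close> occur at time \<open>n\<close>, so it suffices to condition on the events
  \<open>G n = g\<close> of positive probability; the conditional measure is \<^const>\<open>uniform_measure\<close>.
  Vertex \<open>m\<close> has at most \<open>n - 1\<close> incoming arcs at time \<open>n\<close>, so \<open>f (in_degree g m) / n \<le> 1\<close>.
\<close>

locale attachment_network = prob_space M
  for M :: "'a measure" +
  fixes f :: "nat \<Rightarrow> real"
    and G :: "nat \<Rightarrow> 'a \<Rightarrow> nat pair_pre_digraph"
  assumes rule: "attachment_rule f"
    and random_graph: "\<And>n. n \<ge> 1 \<Longrightarrow> G n \<in> M \<rightarrow>\<^sub>M count_space UNIV"
    and initial: "\<And>\<omega>. \<omega> \<in> space M \<Longrightarrow> G 1 \<omega> = \<lparr> pverts = {1}, parcs = {} \<rparr>"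
    and new_vertex: "\<And>n \<omega>. n \<ge> 1 \<Longrightarrow> \<omega> \<in> space M \<Longrightarrow>
      pverts (G (n + 1) \<omega>) = insert (n + 1) (pverts (G n \<omega>))"
    and new_arcs: "\<And>n \<omega>. n \<ge> 1 \<Longrightarrow> \<omega> \<in> space M \<Longrightarrow>
      \<exists>S \<subseteq> {1..n}. parcs (G (n + 1) \<omega>) = parcs (G n \<omega>) \<union> {n + 1} \<times> S"
    and arc_prob: "\<And>n g m. n \<ge> 1 \<Longrightarrow> prob {\<omega> \<in> space M. G n \<omega> = g} > 0 \<Longrightarrow> m \<in> {1..n} \<Longrightarrow>
      measure (uniform_measure M {\<omega> \<in> space M. G n \<omega> = g})
        {\<omega> \<in> space M. (n + 1, m) \<in> parcs (G (n + 1) \<omega>)} = f (in_degree (with_proj g) m) / real n"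
    and arc_indep: "\<And>n g. n \<ge> 1 \<Longrightarrow> prob {\<omega> \<in> space M. G n \<omega> = g} > 0 \<Longrightarrow>
      prob_space.indep_events (uniform_measure M {\<omega> \<in> space M. G n \<omega> = g})
        (\<lambda>m. {\<omega> \<in> space M. (n + 1, m) \<in> parcs (G (n + 1) \<omega>)}) {1..n}"

end

theory Submission
  imports Defs "HOL-Real_Asymp.Real_Asymp"
begin

text \<open>
  Write \<open>Z\<^sub>n\<close> for the indegree of vertex \<open>m\<close> at time \<open>n\<close>. Given the graph at time \<open>n \<ge> m\<close>, the value
  \<open>\<Phi>(Z\<^sub>n)\<close> jumps by \<open>1 / f(Z\<^sub>n)\<close> with probability \<open>f(Z\<^sub>n) / n\<close>. The function \<open>\<Phi>\<close> is made so that the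
  mean of this increment is \<open>1 / n\<close>, whatever the graph, so
  \<open>X\<^sub>n = \<Phi>(Z\<^sub>n) - (\<Psi>(n) - \<Psi>(m))\<close> is a martingale with value \<open>0\<close> at time \<open>m\<close>. The conditional variance of its
  increment is at most \<open>1 / (n f(Z\<^sub>n)) \<le> 1 / (n f(0))\<close>, and orthogonality of the increments
  gives \<open>E(X\<^sub>n\<^sup>2) \<le> \<Psi>(n) / f(0)\<close> (lemma \<open>compensated_second_moment\<close>).

  A sparse sequence of times turns this bound into a strong law. Let \<open>\<tau>\<^sub>k\<close> be the first time with \<open>\<Psi>(\<tau>\<^sub>k) \<ge> k\<^sup>2\<close>. Since \<open>\<Psi>\<close> has steps of size at most \<open>1\<close>, we have
  \<open>\<Psi>(\<tau>\<^sub>k) \<le> k\<^sup>2 + 1\<close>, and so the second moments of \<open>X\<close> at \<open>\<tau>\<^sub>k\<close>, divided by \<open>k\<^sup>4\<close>, are summable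
  in \<open>k\<close>. Hence \<open>\<Phi>(Z) / k\<^sup>2 \<rightarrow> 1\<close> almost surely along \<open>\<tau>\<^sub>k\<close>. Both \<open>\<Phi>(Z\<^sub>n)\<close> and \<open>\<Psi>(n)\<close> increase in
  \<open>n\<close> and consecutive squares have ratio tending to \<open>1\<close>, so the limit extends to all \<open>n\<close> (lemma
  \<open>ratio_tendsto_1_of_squares\<close>).
\<close>

section \<open>Two limit lemmas\<close>

text \<open>
  By monotone convergence the sum of the \<open>Y k\<close> has finite expectation, so it converges almost
  surely and its terms tend to \<open>0\<close>.
\<close>

lemma AE_tendsto_0_of_summable_integrals:
  fixes Y :: "nat \<Rightarrow> 'a \<Rightarrow> real"
  assumes int: "\<And>k. integrable M (Y k)"
    and nonneg: "\<And>k \<omega>. 0 \<le> Y k \<omega>"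
    and summ: "summable (\<lambda>k. integral\<^sup>L M (Y k))"
  shows "AE \<omega> in M. (\<lambda>k. Y k \<omega>) \<longlonglongrightarrow> 0"
proof -
  have [measurable]: "\<And>k. Y k \<in> borel_measurable M" using int by auto
  have "(\<integral>\<^sup>+\<omega>. (\<Sum>k. ennreal (Y k \<omega>)) \<partial>M) = (\<Sum>k. \<integral>\<^sup>+\<omega>. ennreal (Y k \<omega>) \<partial>M)"
    by (rule nn_integral_suminf) auto
  also have "\<dots> = (\<Sum>k. ennreal (integral\<^sup>L M (Y k)))"
    using int nonneg by (simp add: nn_integral_eq_integral)
  also have "\<dots> = ennreal (\<Sum>k. integral\<^sup>L M (Y k))"
    using summ nonneg by (intro suminf_ennreal2) auto
  finally have "(\<integral>\<^sup>+\<omega>. (\<Sum>k. ennreal (Y k \<omega>)) \<partial>M) \<noteq> \<infinity>" by simp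
  then have "AE \<omega> in M. (\<Sum>k. ennreal (Y k \<omega>)) \<noteq> \<infinity>"
    by (intro nn_integral_noteq_infinite) auto
  then show ?thesis
  proof eventually_elim
    case (elim \<omega>)
    then have "summable (\<lambda>k. Y k \<omega>)"
      using nonneg by (intro summable_suminf_not_top) auto
    then show ?case by (rule summable_LIMSEQ_zero)
  qed
qed

text \<open>
  Between \<open>\<tau> k\<close> and \<open>\<tau> (k + 1)\<close>, where \<open>k = \<lfloor>sqrt (b n)\<rfloor>\<close>, the ratio \<open>a n / b n\<close> is squeezed between
  \<open>a (\<tau> k) / (k + 1)\<^sup>2\<close> and \<open>a (\<tau> (k + 1)) / k\<^sup>2\<close>, and the ratio of consecutive squares tends to \<open>1\<close>.
  The starting point \<open>n\<^sub>0\<close> serves processes that are unconstrained at time \<open>0\<close>.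
\<close>

lemma ratio_tendsto_1_of_squares:
  fixes a b :: "nat \<Rightarrow> real" and \<tau> :: "nat \<Rightarrow> nat"
  assumes a_mono: "\<And>i j. n\<^sub>0 \<le> i \<Longrightarrow> i \<le> j \<Longrightarrow> a i \<le> a j"
    and a_nonneg: "\<And>i. 0 \<le> a i"
    and b_top: "filterlim b at_top sequentially"
    and before: "\<And>k n. (real k)\<^sup>2 \<le> b n \<Longrightarrow> \<tau> k \<le> n"
    and after: "\<And>k n. b n < (real k)\<^sup>2 \<Longrightarrow> n \<le> \<tau> k"
    and \<tau>_top: "filterlim \<tau> at_top sequentially"
    and lim: "(\<lambda>k. a (\<tau> k) / (real k)\<^sup>2) \<longlonglongrightarrow> 1"
  shows "(\<lambda>n. a n / b n) \<longlonglongrightarrow> 1"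
proof -
  define r where "r n = nat \<lfloor>sqrt (b n)\<rfloor>" for n
  have r_top: "filterlim r at_top sequentially"
    unfolding r_def
    by (intro filterlim_compose[OF filterlim_nat_sequentially]
        filterlim_compose[OF filterlim_floor_sequentially]
        filterlim_compose[OF sqrt_at_top b_top])
  have sq: "(\<lambda>k. (real k)\<^sup>2 / (real (Suc k))\<^sup>2) \<longlonglongrightarrow> 1"
    by real_asymp
  have sq': "(\<lambda>k. (real (Suc k))\<^sup>2 / (real k)\<^sup>2) \<longlonglongrightarrow> 1"
    by real_asymp
  have low: "(\<lambda>k. a (\<tau> k) / (real (Suc k))\<^sup>2) \<longlonglongrightarrow> 1"
  proof (rule Lim_transform_eventually)
    show "(\<lambda>k. (a (\<tau> k) / (real k)\<^sup>2) * ((real k)\<^sup>2 / (real (Suc k))\<^sup>2)) \<longlonglongrightarrow> 1"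
      using tendsto_mult[OF lim sq] by simp
    show "\<forall>\<^sub>F k in sequentially. (a (\<tau> k) / (real k)\<^sup>2) * ((real k)\<^sup>2 / (real (Suc k))\<^sup>2)
        = a (\<tau> k) / (real (Suc k))\<^sup>2"
      using eventually_gt_at_top[of 0] by eventually_elim simp
  qed
  have up: "(\<lambda>k. a (\<tau> (Suc k)) / (real k)\<^sup>2) \<longlonglongrightarrow> 1"
  proof (rule Lim_transform_eventually)
    show "(\<lambda>k. (a (\<tau> (Suc k)) / (real (Suc k))\<^sup>2) * ((real (Suc k))\<^sup>2 / (real k)\<^sup>2)) \<longlonglongrightarrow> 1"
      using tendsto_mult[OF LIMSEQ_Suc[OF lim] sq'] by simp
    show "\<forall>\<^sub>F k in sequentially. (a (\<tau> (Suc k)) / (real (Suc k))\<^sup>2) * ((real (Suc k))\<^sup>2 / (real k)\<^sup>2)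
        = a (\<tau> (Suc k)) / (real k)\<^sup>2"
      by (intro always_eventually allI) (simp del: of_nat_Suc)
  qed
  have late: "\<forall>\<^sub>F n in sequentially. n\<^sub>0 \<le> \<tau> (r n) \<and> n\<^sub>0 \<le> n \<and> 1 \<le> r n \<and> 1 \<le> b n"
    using filterlim_compose[OF \<tau>_top r_top] r_top b_top
    by (auto simp: filterlim_at_top eventually_conj_iff eventually_ge_at_top)
  have bounds: "\<forall>\<^sub>F n in sequentially. a (\<tau> (r n)) / (real (Suc (r n)))\<^sup>2 \<le> a n / b n
      \<and> a n / b n \<le> a (\<tau> (Suc (r n))) / (real (r n))\<^sup>2"
    using late
  proof eventually_elim
    case (elim n)
    have "real (r n) \<le> sqrt (b n)" "sqrt (b n) < real (Suc (r n))"
      using elim by (auto simp: r_def; linarith)+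
    then have b1: "(real (r n))\<^sup>2 \<le> b n" and b2: "b n < (real (Suc (r n)))\<^sup>2"
      using elim power_mono[of "real (r n)" "sqrt (b n)" 2]
        power_strict_mono[of "sqrt (b n)" "real (Suc (r n))" 2]
      by (simp_all del: of_nat_Suc)
    have "a (\<tau> (r n)) \<le> a n" "a n \<le> a (\<tau> (Suc (r n)))"
      using a_mono elim before[OF b1] after[OF b2] by auto
    then show ?case
      using b1 b2 elim a_nonneg by (intro conjI frac_le) auto
  qed
  show ?thesis
    by (rule tendsto_sandwich[OF _ _ filterlim_compose[OF low r_top] filterlim_compose[OF up r_top]])
       (use bounds in \<open>auto elim: eventually_mono\<close>)
qed

section \<open>The harmonic sums\<close>

lemma Psi_Suc: "n \<ge> 1 \<Longrightarrow> Psi (Suc n) = Psi n + 1 / real n"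
  by (simp add: Psi_def)

lemma Psi_eq_harm: "Psi (Suc n) = harm n"
  by (auto simp: Psi_def harm_def atLeastLessThanSuc_atLeastAtMost inverse_eq_divide)

lemma Psi_at_top: "filterlim Psi at_top sequentially"
proof -
  have "filterlim (\<lambda>n. Psi (Suc n)) at_top sequentially"
    unfolding Psi_eq_harm by (rule harm_at_top)
  then show ?thesis by (rule filterlim_sequentially_Suc[THEN iffD1])
qed

lemma Psi_mono: "i \<le> j \<Longrightarrow> Psi i \<le> Psi j"
  unfolding Psi_def by (rule sum_mono2) auto

lemma Psi_nonneg: "0 \<le> Psi n"
  unfolding Psi_def by (rule sum_nonneg) auto

text \<open>
  The values \<open>\<Psi>(square_time k) \<approx> k\<^sup>2\<close> grow fast enough for \<open>\<Sum> 1 / \<Psi>(square_time k)\<close> to converge, and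
  slowly enough for consecutive values to have ratio tending to \<open>1\<close>; geometric growth would fail
  the second requirement.
\<close>

definition square_time :: "nat \<Rightarrow> nat" where
  "square_time k = (LEAST n. (real k)\<^sup>2 \<le> Psi n)"

lemma square_time_ge: "(real k)\<^sup>2 \<le> Psi (square_time k)"
proof -
  have "\<forall>\<^sub>F n in sequentially. (real k)\<^sup>2 \<le> Psi n"
    using Psi_at_top by (simp add: filterlim_at_top)
  then obtain n where "(real k)\<^sup>2 \<le> Psi n" by (auto simp: eventually_sequentially)
  then show ?thesis unfolding square_time_def by (rule LeastI)
qed

lemma square_time_le: "(real k)\<^sup>2 \<le> Psi n \<Longrightarrow> square_time k \<le> n"
  unfolding square_time_def by (rule Least_le)

lemma less_square_time: "Psi n < (real k)\<^sup>2 \<Longrightarrow> n < square_time k"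
  using square_time_ge[of k] Psi_mono[of "square_time k" n] by force

lemma Psi_square_time_le: "Psi (square_time k) \<le> (real k)\<^sup>2 + 1"
proof (cases "square_time k \<le> 1")
  case True
  then have "Psi (square_time k) = 0" by (simp add: Psi_def)
  then show ?thesis by simp
next
  case False
  define n where "n = square_time k - 1"
  have n: "square_time k = Suc n" "n \<ge> 1" using False by (auto simp: n_def)
  have "Psi n < (real k)\<^sup>2" using square_time_le[of k n] n by force
  moreover have "1 / real n \<le> 1" using n by simp
  ultimately show ?thesis unfolding n(1) Psi_Suc[OF n(2)] by linarith
qed

lemma square_time_at_top: "filterlim square_time at_top sequentially"
  unfolding filterlim_at_top
proof
  fix N :: nat
  have "filterlim (\<lambda>k. (real k)\<^sup>2) at_top sequentially" by real_asymp
  then have "\<forall>\<^sub>F k in sequentially. Psi N < (real k)\<^sup>2"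
    by (simp add: filterlim_at_top_dense)
  then show "\<forall>\<^sub>F k in sequentially. N \<le> square_time k"
    by eventually_elim (use less_square_time in \<open>simp add: less_imp_le\<close>)
qed

section \<open>The indegree process\<close>

lemma in_degree_with_proj: "in_degree (with_proj g) m = card {e \<in> parcs g. snd e = m}"
  by (simp add: in_degree_def in_arcs_def)

lemma (in attachment_network) graph_support:
  assumes "n \<ge> 1" "\<omega> \<in> space M"
  shows "pverts (G n \<omega>) = {1..n}" and "parcs (G n \<omega>) \<subseteq> {(i, j). j < i \<and> i \<le> n}"
proof -
  have "pverts (G n \<omega>) = {1..n} \<and> parcs (G n \<omega>) \<subseteq> {(i, j). j < i \<and> i \<le> n}"
    using \<open>n \<ge> 1\<close>
  proof (induction n rule: dec_induct)
    case base
    show ?case using initial[OF \<open>\<omega> \<in> space M\<close>] by simp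
  next
    case (step n)
    obtain S where "S \<subseteq> {1..n}" "parcs (G (n + 1) \<omega>) = parcs (G n \<omega>) \<union> {n + 1} \<times> S"
      using new_arcs[of n \<omega>] step assms by auto
    moreover have "pverts (G (n + 1) \<omega>) = insert (n + 1) (pverts (G n \<omega>))"
      using new_vertex[of n \<omega>] step assms by auto
    ultimately show ?case using step.IH by fastforce
  qed
  then show "pverts (G n \<omega>) = {1..n}" and "parcs (G n \<omega>) \<subseteq> {(i, j). j < i \<and> i \<le> n}" by auto
qed

lemma (in attachment_network) finite_parcs:
  assumes "n \<ge> 1" "\<omega> \<in> space M"
  shows "finite (parcs (G n \<omega>))"
  by (rule finite_subset[of _ "{..n} \<times> {..n}"]) (use graph_support(2)[OF assms] in auto)

lemma (in attachment_network) finite_graph_range: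
  assumes "n \<ge> 1"
  shows "finite (G n ` space M)"
proof (rule finite_subset)
  show "G n ` space M \<subseteq> (\<lambda>A. \<lparr>pverts = {1..n}, parcs = A\<rparr>) ` Pow ({..n} \<times> {..n})"
  proof
    fix g assume "g \<in> G n ` space M"
    then have "pverts g = {1..n}" "parcs g \<subseteq> {..n} \<times> {..n}"
      using graph_support assms by force+
    then show "g \<in> (\<lambda>A. \<lparr>pverts = {1..n}, parcs = A\<rparr>) ` Pow ({..n} \<times> {..n})"
      by (intro image_eqI[of _ _ "parcs g"]) auto
  qed
qed simp

lemma (in attachment_network) in_degree_birth:
  assumes "m \<ge> 1" "\<omega> \<in> space M"
  shows "in_degree (with_proj (G m \<omega>)) m = 0"
proof -
  have "{e \<in> parcs (G m \<omega>). snd e = m} = {}"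
    using graph_support(2)[OF assms] by auto
  then show ?thesis by (simp only: in_degree_with_proj card.empty)
qed

lemma (in attachment_network) in_degree_step:
  assumes "n \<ge> 1" "\<omega> \<in> space M"
  shows "in_degree (with_proj (G (Suc n) \<omega>)) m =
    in_degree (with_proj (G n \<omega>)) m + (if (Suc n, m) \<in> parcs (G (Suc n) \<omega>) then 1 else 0)"
proof -
  obtain S where S: "parcs (G (Suc n) \<omega>) = parcs (G n \<omega>) \<union> {Suc n} \<times> S"
    using new_arcs[OF assms] by auto
  have new: "(Suc n, m) \<notin> parcs (G n \<omega>)"
    using graph_support(2)[OF assms] by auto
  have arc: "(Suc n, m) \<in> parcs (G (Suc n) \<omega>) \<longleftrightarrow> m \<in> S"
    unfolding S using new by blast
  let ?E = "{e \<in> parcs (G n \<omega>). snd e = m}"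
  have fin: "finite ?E" using finite_parcs[OF assms] by simp
  show ?thesis
  proof (cases "m \<in> S")
    case True
    have "{e \<in> parcs (G (Suc n) \<omega>). snd e = m} = insert (Suc n, m) ?E"
      unfolding S using True by auto
    moreover have "card (insert (Suc n, m) ?E) = card ?E + 1"
      using fin new by simp
    ultimately show ?thesis
      using True by (simp only: in_degree_with_proj arc if_True)
  next
    case False
    have "{e \<in> parcs (G (Suc n) \<omega>). snd e = m} = ?E"
      unfolding S using False by auto
    then show ?thesis
      using False by (simp only: in_degree_with_proj arc if_False)
  qed
qed

lemma (in attachment_network) in_degree_mono:
  assumes "1 \<le> i" "i \<le> j" "\<omega> \<in> space M"
  shows "in_degree (with_proj (G i \<omega>)) m \<le> in_degree (with_proj (G j \<omega>)) m"
  using assms(2)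
proof (induction j rule: dec_induct)
  case (step n)
  then show ?case using in_degree_step[of n \<omega> m] assms by auto
qed simp

section \<open>The compensated process\<close>

lemma (in attachment_network) f_pos: "0 < f k"
  using rule by (simp add: attachment_rule_def)

lemma (in attachment_network) f_ge_f0: "f 0 \<le> f k"
  using rule by (simp add: attachment_rule_def monoD)

lemma (in attachment_network) Phi_nonneg: "0 \<le> Phi f k"
  unfolding Phi_def using f_pos by (intro sum_nonneg) (simp add: less_imp_le)

lemma (in attachment_network) Phi_mono: "i \<le> j \<Longrightarrow> Phi f i \<le> Phi f j"
  unfolding Phi_def using f_pos by (intro sum_mono2) (auto simp: less_imp_le)

lemma (in attachment_network) integrable_graph_function:
  fixes F :: "nat pair_pre_digraph \<Rightarrow> real"
  assumes "n \<ge> 1"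
  shows "integrable M (\<lambda>\<omega>. F (G n \<omega>))"
proof (rule integrable_const_bound)
  show "(\<lambda>\<omega>. F (G n \<omega>)) \<in> borel_measurable M"
    using random_graph[OF assms] by (rule measurable_compose) simp
  show "AE \<omega> in M. norm (F (G n \<omega>)) \<le> Max ((\<lambda>g. norm (F g)) ` (G n ` space M))"
    by (intro AE_I2 Max_ge) (use finite_graph_range[OF assms] in auto)
qed

lemma (in attachment_network) graph_event:
  assumes "n \<ge> 1"
  shows "{\<omega> \<in> space M. P (G n \<omega>)} \<in> events"
proof -
  have "G n -` {g. P g} \<inter> space M \<in> events"
    using random_graph[OF assms] by (rule measurable_sets) simp
  also have "G n -` {g. P g} \<inter> space M = {\<omega> \<in> space M. P (G n \<omega>)}" by auto
  finally show ?thesis .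
qed

text \<open>
  The conditional law of a single arc in integrated form: against functions of the current
  graph, the indicator of the arc may be replaced by its conditional probability. As only finitely
  many graphs occur, both sides are sums over the possible graphs.
\<close>

lemma (in attachment_network) expectation_arc:
  fixes F :: "nat pair_pre_digraph \<Rightarrow> real"
  assumes "1 \<le> m" "m \<le> n"
  defines "A \<equiv> {\<omega> \<in> space M. (Suc n, m) \<in> parcs (G (Suc n) \<omega>)}"
  shows "integrable M (\<lambda>\<omega>. F (G n \<omega>) * indicator A \<omega>)"
    and "(\<integral>\<omega>. F (G n \<omega>) * indicator A \<omega> \<partial>M) =
      (\<integral>\<omega>. F (G n \<omega>) * (f (in_degree (with_proj (G n \<omega>)) m) / real n) \<partial>M)"
proof -
  have n: "n \<ge> 1" using assms by simp
  let ?S = "G n ` space M"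
  let ?B = "\<lambda>g. {\<omega> \<in> space M. G n \<omega> = g}"
  have fin: "finite ?S" by (rule finite_graph_range[OF n])
  have A: "A \<in> events" unfolding A_def by (rule graph_event) simp
  have B: "?B g \<in> events" for g by (rule graph_event[OF n])
  show int: "integrable M (\<lambda>\<omega>. F (G n \<omega>) * indicator A \<omega>)"
    using integrable_graph_function[OF n, of F] A by (rule integrable_real_mult_indicator[rotated])
  have cond: "prob (?B g \<inter> A) = prob (?B g) * (f (in_degree (with_proj g) m) / real n)" for g
  proof (cases "prob (?B g) > 0")
    case True
    have "measure (uniform_measure M (?B g)) A = f (in_degree (with_proj g) m) / real n"
      using arc_prob[OF n True, of m] assms by simp
    moreover have "measure (uniform_measure M (?B g)) A = prob (?B g \<inter> A) / prob (?B g)"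
      using True B A by (intro measure_uniform_measure) (auto simp: emeasure_eq_measure)
    ultimately show ?thesis using True by (simp add: field_simps)
  next
    case False
    then have "prob (?B g) = 0" by (simp add: zero_less_measure_iff)
    moreover have "prob (?B g \<inter> A) \<le> prob (?B g)" by (intro finite_measure_mono B) auto
    ultimately show ?thesis by (simp add: measure_le_0_iff)
  qed
  have split: "(\<integral>\<omega>. H (G n \<omega>) * indicator C \<omega> \<partial>M) = (\<Sum>g\<in>?S. H g * prob (?B g \<inter> C))"
    if C: "C \<in> events" for H :: "nat pair_pre_digraph \<Rightarrow> real" and C
  proof -
    have "(\<integral>\<omega>. H (G n \<omega>) * indicator C \<omega> \<partial>M) =
        (\<integral>\<omega>. (\<Sum>g\<in>?S. H g * indicator (?B g \<inter> C) \<omega>) \<partial>M)"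
    proof (rule Bochner_Integration.integral_cong[OF refl])
      fix \<omega> assume \<omega>: "\<omega> \<in> space M"
      have "(\<Sum>g\<in>?S. H g * indicator (?B g \<inter> C) \<omega>) =
          (\<Sum>g\<in>?S. if g = G n \<omega> then H g * indicator C \<omega> else 0)"
        using \<omega> by (intro sum.cong) (auto simp: indicator_def)
      also have "\<dots> = H (G n \<omega>) * indicator C \<omega>"
        using fin \<omega> by simp
      finally show "H (G n \<omega>) * indicator C \<omega> = (\<Sum>g\<in>?S. H g * indicator (?B g \<inter> C) \<omega>)" ..
    qed
    also have "\<dots> = (\<Sum>g\<in>?S. H g * prob (?B g \<inter> C))"
      using B C by (subst Bochner_Integration.integral_sum) (auto simp: emeasure_eq_measure)
    finally show ?thesis .
  qed
  have "(\<integral>\<omega>. F (G n \<omega>) * (f (in_degree (with_proj (G n \<omega>)) m) / real n) \<partial>M) =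
      (\<integral>\<omega>. (F (G n \<omega>) * (f (in_degree (with_proj (G n \<omega>)) m) / real n)) * indicator (space M) \<omega> \<partial>M)"
    by (intro Bochner_Integration.integral_cong) auto
  also have "\<dots> = (\<Sum>g\<in>?S. (F g * (f (in_degree (with_proj g) m) / real n)) * prob (?B g \<inter> space M))"
    by (rule split[of "space M" "\<lambda>g. F g * (f (in_degree (with_proj g) m) / real n)"]) simp
  also have "\<dots> = (\<Sum>g\<in>?S. F g * prob (?B g \<inter> A))"
  proof (intro sum.cong refl)
    fix g
    have "?B g \<inter> space M = ?B g" by auto
    then show "(F g * (f (in_degree (with_proj g) m) / real n)) * prob (?B g \<inter> space M) =
        F g * prob (?B g \<inter> A)"
      by (simp only: cond mult_ac)
  qed
  also have "\<dots> = (\<integral>\<omega>. F (G n \<omega>) * indicator A \<omega> \<partial>M)"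
    by (rule split[OF A, symmetric])
  finally show "(\<integral>\<omega>. F (G n \<omega>) * indicator A \<omega> \<partial>M) =
      (\<integral>\<omega>. F (G n \<omega>) * (f (in_degree (with_proj (G n \<omega>)) m) / real n) \<partial>M)" ..
qed

text \<open>
  The martingale of the proof, as a function of the graph: this form lets its second moment be
  computed from \<open>expectation_arc\<close>.
\<close>

definition compensated :: "(nat \<Rightarrow> real) \<Rightarrow> nat \<Rightarrow> nat \<Rightarrow> nat pair_pre_digraph \<Rightarrow> real" where
  "compensated f m n g = Phi f (in_degree (with_proj g) m) - (Psi n - Psi m)"

text \<open>
  The cross term of the increment with the current value integrates to \<open>0\<close>, because the increment
  has conditional mean \<open>0\<close>; what is left is its variance. In the calculation the square is expanded
  as \<open>h (G n \<omega>)\<close>, plus \<open>j (G n \<omega>)\<close> on the event that the arc is inserted.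
\<close>

lemma (in attachment_network) compensated_second_moment_step:
  assumes "1 \<le> m" "m \<le> n"
  shows "(\<integral>\<omega>. (compensated f m (Suc n) (G (Suc n) \<omega>))\<^sup>2 \<partial>M) \<le>
    (\<integral>\<omega>. (compensated f m n (G n \<omega>))\<^sup>2 \<partial>M) + 1 / (real n * f 0)"
proof -
  have n: "n \<ge> 1" using assms by simp
  define A where "A = {\<omega> \<in> space M. (Suc n, m) \<in> parcs (G (Suc n) \<omega>)}"
  let ?d = "\<lambda>g. f (in_degree (with_proj g) m)"
  let ?X = "compensated f m n"
  define h where "h g = (?X g - 1 / real n)\<^sup>2" for g
  define j where "j g = (?X g - 1 / real n + 1 / ?d g)\<^sup>2 - h g" for g
  have f_nz: "f k \<noteq> 0" for k using f_pos[of k] by simp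
  have step: "(compensated f m (Suc n) (G (Suc n) \<omega>))\<^sup>2 = h (G n \<omega>) + j (G n \<omega>) * indicator A \<omega>"
    if "\<omega> \<in> space M" for \<omega>
    using in_degree_step[OF n that, of m] that
    by (auto simp: compensated_def h_def j_def A_def Psi_Suc[OF n] Phi_def algebra_simps)
  have var: "h g + j g * (?d g / real n) \<le> (?X g)\<^sup>2 + 1 / (real n * f 0)" for g
  proof -
    \<comment> \<open>The terms linear in \<open>?X g\<close> cancel: this is the martingale property.\<close>
    have "h g + j g * (?d g / real n) = (?X g)\<^sup>2 + 1 / (real n * ?d g) - 1 / (real n)\<^sup>2"
      using n f_nz by (simp add: h_def j_def field_simps power2_eq_square)
    also have "\<dots> \<le> (?X g)\<^sup>2 + 1 / (real n * ?d g)" by simp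
    also have "1 / (real n * ?d g) \<le> 1 / (real n * f 0)"
      using n f_pos f_ge_f0 by (intro divide_left_mono mult_left_mono mult_pos_pos) auto
    finally show ?thesis by simp
  qed
  have "(\<integral>\<omega>. (compensated f m (Suc n) (G (Suc n) \<omega>))\<^sup>2 \<partial>M) =
      (\<integral>\<omega>. h (G n \<omega>) + j (G n \<omega>) * indicator A \<omega> \<partial>M)"
    by (intro Bochner_Integration.integral_cong step) auto
  also have "\<dots> = (\<integral>\<omega>. h (G n \<omega>) \<partial>M) + (\<integral>\<omega>. j (G n \<omega>) * indicator A \<omega> \<partial>M)"
    using expectation_arc(1)[OF assms] integrable_graph_function[OF n]
    unfolding A_def by (intro Bochner_Integration.integral_add) auto
  also have "\<dots> = (\<integral>\<omega>. h (G n \<omega>) \<partial>M) + (\<integral>\<omega>. j (G n \<omega>) * (?d (G n \<omega>) / real n) \<partial>M)"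
    unfolding A_def by (simp only: expectation_arc(2)[OF assms])
  also have "\<dots> = (\<integral>\<omega>. h (G n \<omega>) + j (G n \<omega>) * (?d (G n \<omega>) / real n) \<partial>M)"
    by (intro Bochner_Integration.integral_add[symmetric] integrable_graph_function[OF n]
        integrable_graph_function[OF n, of "\<lambda>g. j g * (?d g / real n)"])
  also have "\<dots> \<le> (\<integral>\<omega>. (?X (G n \<omega>))\<^sup>2 + 1 / (real n * f 0) \<partial>M)"
    by (intro integral_mono var integrable_graph_function[OF n, of "\<lambda>g. h g + j g * (?d g / real n)"]
        integrable_graph_function[OF n, of "\<lambda>g. (?X g)\<^sup>2 + 1 / (real n * f 0)"])
  also have "\<dots> = (\<integral>\<omega>. (?X (G n \<omega>))\<^sup>2 \<partial>M) + 1 / (real n * f 0)"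
    using integrable_graph_function[OF n, of "\<lambda>g. (?X g)\<^sup>2"]
    by (subst Bochner_Integration.integral_add) (auto simp: prob_space)
  finally show ?thesis .
qed

lemma (in attachment_network) compensated_second_moment:
  assumes "1 \<le> m" "m \<le> n"
  shows "(\<integral>\<omega>. (compensated f m n (G n \<omega>))\<^sup>2 \<partial>M) \<le> Psi n / f 0"
  using assms(2)
proof (induction n rule: dec_induct)
  case base
  have "(\<integral>\<omega>. (compensated f m m (G m \<omega>))\<^sup>2 \<partial>M) = (\<integral>\<omega>. 0 \<partial>M)"
    using in_degree_birth[OF assms(1)]
    by (intro Bochner_Integration.integral_cong) (auto simp: compensated_def Phi_def)
  then show ?case using Psi_nonneg[of m] f_pos[of 0] by simp
next
  case (step n)
  have "Psi (Suc n) / f 0 = Psi n / f 0 + 1 / (real n * f 0)"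
    using step assms by (simp add: Psi_Suc add_divide_distrib)
  then show ?case
    using step compensated_second_moment_step[OF assms(1), of n] by simp
qed

text \<open>
  The normalised squares have expectation at most \<open>(k\<^sup>2 + 1) / (f 0 k\<^sup>4) \<le> 2 / (f 0 k\<^sup>2)\<close> once
  \<open>k \<ge> 1\<close> and vertex \<open>m\<close> is born by time \<open>square_time k\<close>. This is summable, so the squares tend to
  \<open>0\<close> almost surely.
\<close>

lemma (in attachment_network) compensated_square_time:
  assumes "1 \<le> m"
  shows "AE \<omega> in M. (\<lambda>k. compensated f m (square_time k) (G (square_time k) \<omega>) / (real k)\<^sup>2)
    \<longlonglongrightarrow> 0"
proof -
  have "\<forall>\<^sub>F k in sequentially. m \<le> square_time k \<and> 1 \<le> k"
    using square_time_at_top by (simp add: filterlim_at_top eventually_conj_iff eventually_ge_at_top)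
  \<comment> \<open>The second moment bound only holds from the birth of \<open>m\<close> on, so early indices are dropped.\<close>
  then obtain k\<^sub>0 where k\<^sub>0: "\<And>k. k \<ge> k\<^sub>0 \<Longrightarrow> m \<le> square_time k \<and> 1 \<le> k"
    by (auto simp: eventually_sequentially)
  define Y where "Y k \<omega> =
    (compensated f m (square_time (k + k\<^sub>0)) (G (square_time (k + k\<^sub>0)) \<omega>) / (real (k + k\<^sub>0))\<^sup>2)\<^sup>2" for k \<omega>
  have bound: "integral\<^sup>L M (Y k) \<le> (2 / f 0) * (1 / (real (k + k\<^sub>0))\<^sup>2)" for k
  proof -
    let ?k = "k + k\<^sub>0"
    have k: "m \<le> square_time ?k" "1 \<le> real ?k" using k\<^sub>0[of ?k] by auto
    have "integral\<^sup>L M (Y k) =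
        (\<integral>\<omega>. (compensated f m (square_time ?k) (G (square_time ?k) \<omega>))\<^sup>2 \<partial>M) / (real ?k) ^ 4"
      by (simp add: Y_def[abs_def] power_divide flip: power_mult)
    also have "\<dots> \<le> (((real ?k)\<^sup>2 + 1) / f 0) / (real ?k) ^ 4"
      using compensated_second_moment[OF assms k(1)] Psi_square_time_le[of ?k] f_pos[of 0]
      by (intro divide_right_mono order_trans[OF compensated_second_moment[OF assms k(1)]]) auto
    also have "\<dots> \<le> ((2 * (real ?k)\<^sup>2) / f 0) / (real ?k) ^ 4"
      using f_pos[of 0] one_le_power[OF k(2), of 2] by (intro divide_right_mono) auto
    also have "\<dots> = (2 / f 0) * (1 / (real ?k)\<^sup>2)"
      using k(2) f_pos[of 0] by (simp add: field_simps flip: power_add)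
    finally show ?thesis .
  qed
  have "AE \<omega> in M. (\<lambda>k. Y k \<omega>) \<longlonglongrightarrow> 0"
  proof (rule AE_tendsto_0_of_summable_integrals)
    show "integrable M (Y k)" for k
      unfolding Y_def using k\<^sub>0[of "k + k\<^sub>0"] assms
      by (intro integrable_graph_function[of "square_time (k + k\<^sub>0)"
            "\<lambda>g. (compensated f m (square_time (k + k\<^sub>0)) g / (real (k + k\<^sub>0))\<^sup>2)\<^sup>2"]) auto
    show "0 \<le> Y k \<omega>" for k \<omega> by (simp add: Y_def)
    have "summable (\<lambda>k. 1 / (real (k + k\<^sub>0))\<^sup>2)"
      using inverse_power_summable[of 2, where ?'a = real]
      by (subst summable_iff_shift) (simp add: inverse_eq_divide)
    then have summ: "summable (\<lambda>k. (2 / f 0) * (1 / (real (k + k\<^sub>0))\<^sup>2))" by (rule summable_mult)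
    show "summable (\<lambda>k. integral\<^sup>L M (Y k))"
      by (rule summable_comparison_test'[OF summ, of 0])
         (use bound in \<open>simp add: Y_def[abs_def]\<close>)
  qed
  then show ?thesis
  proof eventually_elim
    case (elim \<omega>)
    from tendsto_real_sqrt[OF elim]
    have "(\<lambda>k. compensated f m (square_time (k + k\<^sub>0)) (G (square_time (k + k\<^sub>0)) \<omega>) / (real (k + k\<^sub>0))\<^sup>2)
        \<longlonglongrightarrow> 0"
      unfolding Y_def real_sqrt_abs real_sqrt_zero by (rule tendsto_rabs_zero_cancel)
    then show ?case by (rule LIMSEQ_offset)
  qed
qed

section \<open>The strong law\<close>

lemma Psi_square_time_ratio: "(\<lambda>k. Psi (square_time k) / (real k)\<^sup>2) \<longlonglongrightarrow> 1"
proof (rule tendsto_sandwich)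
  show "\<forall>\<^sub>F k in sequentially. 1 \<le> Psi (square_time k) / (real k)\<^sup>2"
    using eventually_gt_at_top[of 0]
    by eventually_elim (use square_time_ge in \<open>simp add: le_divide_eq\<close>)
  show "\<forall>\<^sub>F k in sequentially. Psi (square_time k) / (real k)\<^sup>2 \<le> ((real k)\<^sup>2 + 1) / (real k)\<^sup>2"
    by (intro always_eventually allI divide_right_mono Psi_square_time_le) simp
  show "(\<lambda>k. ((real k)\<^sup>2 + 1) / (real k)\<^sup>2) \<longlonglongrightarrow> 1" by real_asymp
qed simp

theorem proposition1p4:
  fixes M :: "'a measure"
    and f :: "nat \<Rightarrow> real"
    and G :: "nat \<Rightarrow> 'a \<Rightarrow> nat pair_pre_digraph"
    and m :: nat
  assumes "attachment_network M f G"
    and "m \<ge> 1"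
  shows "AE \<omega> in M. (\<lambda>n. Phi f (in_degree (with_proj (G n \<omega>)) m) / Psi n) \<longlonglongrightarrow> 1"
proof -
  interpret attachment_network M f G by fact
  show ?thesis
    using compensated_square_time[OF \<open>m \<ge> 1\<close>] AE_space
  proof eventually_elim
    case (elim \<omega>)
    let ?a = "\<lambda>n. Phi f (in_degree (with_proj (G n \<omega>)) m)"
    have const: "(\<lambda>k. Psi m / (real k)\<^sup>2) \<longlonglongrightarrow> 0" by real_asymp
    have "(\<lambda>k. ?a (square_time k) / (real k)\<^sup>2) \<longlonglongrightarrow> 1"
      using tendsto_diff[OF tendsto_add[OF elim(1) Psi_square_time_ratio] const]
      by (simp add: compensated_def diff_divide_distrib)
    then show ?case
    proof (rule ratio_tendsto_1_of_squares[where \<tau> = square_time and n\<^sub>0 = 1, rotated -1])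
      show "?a i \<le> ?a j" if "1 \<le> i" "i \<le> j" for i j
        using that elim(2) by (intro Phi_mono in_degree_mono)
      show "n \<le> square_time k" if "Psi n < (real k)\<^sup>2" for k n
        using less_square_time[OF that] by simp
    qed (fact Phi_nonneg Psi_at_top square_time_le square_time_at_top)+
  qed
qed

end
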